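(* Let $n\ge 2$ be an integer. If $F_n\colon X^n\to X$ is an $n$-associative function having a neutral element $e$, one assigns to it the binary function $F_2\colon X^2\to X$, $F_2(a,b):=F_n(a,e,\ldots,e,b)$ for every $a,b\in X$; denote this map $F_n\mapsto F_2$ by $\mathcal{F}$. Then, for any totally ordered set $X$, the map $\mathcal{F}$ is a bijection between the set of associative idempotent monotone functions on $X$ (that is, functions $X^2\to X$) having neutral elements and the set of $n$-associative idempotent monotone functions on $X$ (that is, functions $X^n\to X$) having neutral elements.
   Context: A function $F\colon X^n\to X$ is $n$-associative if for all $x_1,\ldots,x_{2n-1}\in X$ and all $i=1,\ldots,n-1$, $F(F(x_1,\ldots,x_n),x_{n+1},\ldots,x_{2n-1})=F(x_1,\ldots,x_i,F(x_{i+1},\ldots,x_{i+n}),x_{i+n+1},\ldots,x_{2n-1})$; $2$-associative means associative. $F$ is idempotent if $F(a,\ldots,a)=a$ for all $a\in X$. $F$ is monotone in the $i$-th variable if for all fixed $a_1,\ldots,a_{i-1},a_{i+1},\ldots,a_n\in X$, the one-variable function $x\mapsto F(a_1,\ldots,a_{i-1},x,a_{i+1},\ldots,a_n)$ is order-preserving or order-reversing (non-strictly); $F$ is monotone if it is monotone in each of its variables. An element $e\in X$ is a neutral element of $F$ if $F(e,\ldots,e,x,e,\ldots,e)=x$ for every $x\in X$ and every position $i=1,\ldots,n$ of $x$.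
   Formalization: Monotone in the i-th variable is taken to mean order-preserving for all fixed values of the other variables, or order-reversing for all of them; if the direction may vary with the fixed values, the claim fails (n=3, x+y+z mod 2 on {0<1}). *)

theory Defs
  imports Main "HOL-Library.FuncSet"
begin

text \<open>
  An \<open>n\<close>-tuple over \<open>X = UNIV :: 'a set\<close> is a list of length \<open>n\<close>. A function \<open>X\<^sup>n \<rightarrow> X\<close> is an
  extensional function on the lists of length \<open>n\<close>, so that equality in \<open>nary n\<close> is equality of
  functions on \<open>X\<^sup>n\<close>. Binary functions are the elements of \<open>nary 2\<close>.
\<close>

definition nary :: "nat \<Rightarrow> ('a list \<Rightarrow> 'a) set" where
  "nary n = {xs. length xs = n} \<rightarrow>\<^sub>E UNIV"

definition n_associative :: "nat \<Rightarrow> ('a list \<Rightarrow> 'a) \<Rightarrow> bool" where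
  "n_associative n F \<longleftrightarrow>
     (\<forall>xs. length xs = 2 * n - 1 \<longrightarrow>
        (\<forall>i\<in>{1..n - 1}.
           F (F (take n xs) # drop n xs) =
           F (take i xs @ [F (take n (drop i xs))] @ drop (i + n) xs)))"

definition idempotent :: "nat \<Rightarrow> ('a list \<Rightarrow> 'a) \<Rightarrow> bool" where
  "idempotent n F \<longleftrightarrow> (\<forall>a. F (replicate n a) = a)"

text \<open>
  The direction of monotonicity is a property of the variable: it may depend on \<open>i\<close>, but not on the
  values at which the other variables are fixed. If it could depend on those values, the ternary
  product on the chain \<open>-1 < 0 < 1\<close> would be \<open>3\<close>-associative, idempotent and monotone with neutral
  element \<open>1\<close>, although the binary product, which is assigned to it, is not idempotent.
\<close>

definition monotone_in_variable :: "nat \<Rightarrow> nat \<Rightarrow> ('a::linorder list \<Rightarrow> 'a) \<Rightarrow> bool" where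
  "monotone_in_variable n i F \<longleftrightarrow>
     (\<forall>as. length as = n \<longrightarrow> mono (\<lambda>x. F (as[i := x]))) \<or>
     (\<forall>as. length as = n \<longrightarrow> antimono (\<lambda>x. F (as[i := x])))"

definition monotone_fun :: "nat \<Rightarrow> ('a::linorder list \<Rightarrow> 'a) \<Rightarrow> bool" where
  "monotone_fun n F \<longleftrightarrow> (\<forall>i<n. monotone_in_variable n i F)"

definition neutral_element :: "nat \<Rightarrow> ('a list \<Rightarrow> 'a) \<Rightarrow> 'a \<Rightarrow> bool" where
  "neutral_element n F e \<longleftrightarrow> (\<forall>x. \<forall>i<n. F ((replicate n e)[i := x]) = x)"

definition assoc_idem_mono_neutral :: "nat \<Rightarrow> ('a::linorder list \<Rightarrow> 'a) set" where
  "assoc_idem_mono_neutral n =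
     {F \<in> nary n. n_associative n F \<and> idempotent n F \<and> monotone_fun n F \<and>
                  (\<exists>e. neutral_element n F e)}"

text \<open>\<open>F\<^sub>2(a,b) = F\<^sub>n(a,e,\<dots>,e,b)\<close> with \<open>n - 2\<close> copies of \<open>e\<close>.\<close>

definition binary_part :: "nat \<Rightarrow> 'a \<Rightarrow> ('a list \<Rightarrow> 'a) \<Rightarrow> ('a list \<Rightarrow> 'a)" where
  "binary_part n e F =
     (\<lambda>xs\<in>{xs. length xs = 2}. F ([xs ! 0] @ replicate (n - 2) e @ [xs ! 1]))"

text \<open>
  A function with several neutral elements can have several binary parts, so the assignment
  \<open>F\<^sub>n \<mapsto> F\<^sub>2\<close> picks one of the neutral elements.
\<close>

definition binary_map :: "nat \<Rightarrow> ('a list \<Rightarrow> 'a) \<Rightarrow> ('a list \<Rightarrow> 'a)" where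
  "binary_map n F = binary_part n (SOME e. neutral_element n F e) F"

end

theory Submission
  imports Defs
begin

text \<open>
  Fixing all variables of \<open>F\<^sub>n\<close> but one at \<open>e\<close> leaves the identity map, which is decreasing only
  if \<open>X\<close> has at most one element; so \<open>F\<^sub>n\<close> is increasing in each variable. Padding with copies of \<open>e\<close>
  and shifting the inner bracket shows that \<open>F\<^sub>n\<close> is the \<open>n\<close>-fold product of the monoid with
  operation \<open>F\<^sub>2\<close> and unit \<open>e\<close>. Idempotency of \<open>F\<^sub>n\<close> reads \<open>a\<^sup>n = a\<close>; for \<open>a \<ge> e\<close> this gives
  \<open>a \<le> a\<^sup>2 \<le> a\<^sup>n = a\<close>, dually for \<open>a \<le> e\<close>, so \<open>F\<^sub>2\<close> is idempotent. Hence the neutral element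
  of \<open>F\<^sub>n\<close> is unique, and taking \<open>n\<close>-fold products inverts \<open>F\<^sub>n \<mapsto> F\<^sub>2\<close>.
\<close>

section \<open>Products over lists in monoids and ordered bands\<close>

declare foldr_replicate [simp del]

text \<open>A band is an idempotent semigroup. Monotone here means increasing: a unit excludes
  decreasing variables on a nontrivial chain.\<close>

locale monotone_band = monoid f e
  for f :: "'a::linorder \<Rightarrow> 'a \<Rightarrow> 'a" and e :: 'a +
  assumes f_mono: "a \<le> b \<Longrightarrow> c \<le> d \<Longrightarrow> f a c \<le> f b d"
    and f_idem: "f a a = a"

text \<open>Curried form of \<open>binary_part\<close>, able to instantiate the locale
  \<open>monoid\<close>.\<close>

definition binary_op :: "nat \<Rightarrow> 'a \<Rightarrow> ('a list \<Rightarrow> 'a) \<Rightarrow> 'a \<Rightarrow> 'a \<Rightarrow> 'a" where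
  "binary_op n e F a b = F ([a] @ replicate (n - 2) e @ [b])"

text \<open>For \<open>n = 2\<close> this also turns a curried operation back into an element of
  \<open>nary 2\<close>.\<close>

definition nary_product :: "nat \<Rightarrow> ('a \<Rightarrow> 'a \<Rightarrow> 'a) \<Rightarrow> 'a \<Rightarrow> 'a list \<Rightarrow> 'a" where
  "nary_product n f e = (\<lambda>xs\<in>{xs. length xs = n}. foldr f xs e)"

lemma nary_product_apply: "length xs = n \<Longrightarrow> nary_product n f e xs = foldr f xs e"
  by (simp add: nary_product_def)

context monoid
begin

text \<open>Here \<open>z\<close> is the unit fixed by the locale \<open>monoid\<close>; any other
  start value would be counted twice on the right.\<close>

lemma foldr_append_unit: "foldr f (xs @ ys) z = f (foldr f xs z) (foldr f ys z)"
  by (induction xs) (simp_all add: assoc)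

lemma foldr_replicate_unit: "foldr f (replicate k z) z = z"
  by (induction k) simp_all

lemma foldr_update_unit: "i < k \<Longrightarrow> foldr f ((replicate k z)[i := x]) z = x"
proof (induction k arbitrary: i)
  case (Suc k)
  then show ?case by (cases i) (simp_all add: foldr_replicate_unit)
qed simp

text \<open>Both bracketings evaluate to the product of all \<open>2 * n - 1\<close>
  entries.\<close>

lemma nary_product_assoc:
  assumes "n \<ge> 1"
  shows "n_associative n (nary_product n f z)"
  unfolding n_associative_def
proof (intro allI impI ballI)
  fix xs :: "'a list" and i
  assume len: "length xs = 2 * n - 1" and i: "i \<in> {1..n - 1}"
  have "xs = take i xs @ take n (drop i xs) @ drop (i + n) xs"
    by (metis add.commute append_take_drop_id drop_drop)
  then have "foldr f xs z =
      f (foldr f (take i xs) z) (f (foldr f (take n (drop i xs)) z) (foldr f (drop (i + n) xs) z))"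
    by (metis foldr_append_unit)
  moreover have "foldr f xs z = f (foldr f (take n xs) z) (foldr f (drop n xs) z)"
    by (metis append_take_drop_id foldr_append_unit)
  \<comment> \<open>\<open>nary_product\<close> agrees with \<open>foldr\<close> only on lists of
    length \<open>n\<close>.\<close>
  moreover have "length (take n xs) = n" "length (y # drop n xs) = n"
    "length (take n (drop i xs)) = n" "length (take i xs @ y # drop (i + n) xs) = n" for y
    using len i assms by auto
  ultimately show "nary_product n f z (nary_product n f z (take n xs) # drop n xs) =
      nary_product n f z
        (take i xs @ [nary_product n f z (take n (drop i xs))] @ drop (i + n) xs)"
    by (simp add: nary_product_apply foldr_append_unit del: foldr_append length_take length_drop
        length_append length_Cons)
qed

lemma nary_product_neutral: "neutral_element n (nary_product n f z) z"
  by (simp add: neutral_element_def nary_product_apply foldr_update_unit)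

lemma binary_op_nary_product: "n \<ge> 2 \<Longrightarrow> binary_op n z (nary_product n f z) = f"
  by (intro ext) (simp add: binary_op_def nary_product_apply foldr_append_unit
      foldr_replicate_unit del: foldr_append)

end

context monotone_band
begin

lemma foldr_update_mono: "x \<le> y \<Longrightarrow> foldr f (as[i := x]) e \<le> foldr f (as[i := y]) e"
proof (induction as arbitrary: i)
  case (Cons a as)
  then show ?case by (cases i) (simp_all add: f_mono)
qed simp

lemma foldr_replicate_idem: "foldr f (replicate (Suc k) a) e = a"
  by (induction k) (simp_all add: f_idem)

lemma nary_product_mem:
  assumes "n \<ge> 1"
  shows "nary_product n f e \<in> assoc_idem_mono_neutral n"
proof -
  have "nary_product n f e \<in> nary n"
    by (simp add: nary_def nary_product_def)
  moreover have "idempotent n (nary_product n f e)"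
    using assms by (cases n)
      (auto simp: idempotent_def nary_product_apply foldr_replicate_idem
        simp del: replicate_Suc)
  moreover have "monotone_fun n (nary_product n f e)"
    by (auto simp: monotone_fun_def monotone_in_variable_def nary_product_apply mono_def
        intro: foldr_update_mono)
  ultimately show ?thesis
    using nary_product_assoc[OF assms] nary_product_neutral
    by (auto simp: assoc_idem_mono_neutral_def)
qed

lemma nary_product_neutral_unique:
  assumes "n \<ge> 2" and "neutral_element n (nary_product n f e) e'"
  shows "e' = e"
proof -
  obtain k where n: "n = Suc (Suc k)"
    using assms(1) by (metis Suc_le_D numeral_2_eq_2 Suc_le_mono)
  \<comment> \<open>Neutrality of \<open>e'\<close> applied to \<open>e\<close> at position 0: the
    product is \<open>e\<close> times a positive power of \<open>e'\<close>, which collapses to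
    \<open>e'\<close>.\<close>
  have "e = nary_product n f e ((replicate n e')[0 := e])"
    using assms unfolding neutral_element_def by simp
  also have "\<dots> = e'"
    using n foldr_replicate_idem[of k e'] by (simp add: nary_product_apply)
  finally show ?thesis by simp
qed

end

section \<open>Functions with a neutral element as products in a monoid\<close>

lemma n_associative_shift:
  assumes assoc: "n_associative n F" and n: "n \<ge> 1"
    and len: "length vs = n" "length us + length ws = n - 1"
      "length vs' = n" "length us' + length ws' = n - 1"
    and eq: "us @ vs @ ws = us' @ vs' @ ws'"
  shows "F (us @ [F vs] @ ws) = F (us' @ [F vs'] @ ws')"
proof -
  \<comment> \<open>Any two brackets agree because each agrees with the leftmost one. Empty
    \<open>us\<close> is separate, as the definition starts at \<open>i = 1\<close>.\<close>
  have left: "F (us @ [F vs] @ ws) = F (F (take n xs) # drop n xs)"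
    if "length vs = n" "length us + length ws = n - 1" "xs = us @ vs @ ws" for us vs ws xs
  proof (cases "us = []")
    case False
    then have "length us \<in> {1..n - 1}" "length xs = 2 * n - 1"
      using that n by (auto simp: Suc_le_eq)
    with assoc have "F (F (take n xs) # drop n xs) =
        F (take (length us) xs @ [F (take n (drop (length us) xs))] @ drop (length us + n) xs)"
      unfolding n_associative_def by blast
    with that show ?thesis by simp
  qed (use that in simp)
  show ?thesis using left[OF len(1,2) refl] left[OF len(3,4) eq] by simp
qed

locale neutral_n_associative =
  fixes n :: nat and F :: "'a list \<Rightarrow> 'a" and e :: 'a
  assumes n2: "n \<ge> 2" and n_assoc: "n_associative n F" and neutral: "neutral_element n F e"
begin

abbreviation op2 (infixl "\<bullet>" 70) where "a \<bullet> b \<equiv> binary_op n e F a b"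

lemma F_padded:
  assumes "k + l = n - 1"
  shows "F (replicate k e @ [x] @ replicate l e) = x"
proof -
  have "replicate n e = replicate k e @ e # replicate l e"
    using assms n2 by (simp flip: replicate_Suc replicate_add)
  then have "(replicate n e)[k := x] = replicate k e @ [x] @ replicate l e"
    by (simp add: list_update_append)
  moreover have "k < n" using assms n2 by simp
  ultimately show ?thesis using neutral unfolding neutral_element_def by metis
qed

sublocale monoid "binary_op n e F" e
proof
  fix a b c
  \<comment> \<open>The list \<open>a, e, ..., e, b, e, ..., e, c\<close> of length
    \<open>2 * n - 1\<close> is bracketed at its first and at its last \<open>n\<close>
    entries.\<close>
  show "a \<bullet> b \<bullet> c = a \<bullet> (b \<bullet> c)"
    unfolding binary_op_def
    using n_associative_shift[OF n_assoc, of "[a] @ replicate (n - 2) e @ [b]" "[]"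
        "replicate (n - 2) e @ [c]" "[b] @ replicate (n - 2) e @ [c]"
        "[a] @ replicate (n - 2) e" "[]"] n2
    by simp
  have "n - 1 = Suc (n - 2)" using n2 by simp
  then show "e \<bullet> a = a" "a \<bullet> e = a"
    using F_padded[of "n - 1" 0 a] F_padded[of 0 "n - 1" a]
    by (simp_all add: binary_op_def replicate_append_same)
qed

text \<open>Adjacent entries \<open>b\<close>, \<open>a\<close> before the padding merge into
  \<open>b \<bullet> a\<close>, which frees a slot for \<open>e\<close>; repeating this from the
  right yields the fold.\<close>

lemma F_padded_product:
  "length us \<le> n - 1 \<Longrightarrow>
    F (us @ [a] @ replicate (n - 1 - length us) e) = foldr (binary_op n e F) us a"
proof (induction us arbitrary: a rule: rev_induct)
  case Nil
  then show ?case using F_padded[of 0 "n - 1" a] by simp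
next
  case (snoc b us)
  let ?l = "n - 1 - length (us @ [b])"
  \<comment> \<open>By neutrality \<open>?vs\<close> evaluates to \<open>a\<close>; moving the
    bracket one place left takes in \<open>b\<close> and releases the final \<open>e\<close> into
    the padding.\<close>
  let ?vs = "replicate (n - 2) e @ [a] @ [e]"
  have "F ((us @ [b]) @ [F ?vs] @ replicate ?l e) =
      F (us @ [b \<bullet> a] @ replicate (Suc ?l) e)"
    unfolding binary_op_def by (rule n_associative_shift[OF n_assoc]) (use n2 snoc.prems in auto)
  moreover have "F ?vs = a"
    using F_padded[of "n - 2" 1 a] n2 by simp
  moreover have "Suc ?l = n - 1 - length us"
    using snoc.prems by simp
  moreover have "F (us @ [b \<bullet> a] @ replicate (n - 1 - length us) e) =
      foldr (binary_op n e F) us (b \<bullet> a)"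
    using snoc.prems by (intro snoc.IH) simp
  ultimately show ?case
    by (simp del: replicate_Suc)
qed

lemma F_eq_product:
  assumes "length xs = n"
  shows "F xs = foldr (binary_op n e F) xs e"
proof -
  obtain us a where xs: "xs = us @ [a]"
    using assms n2 by (cases xs rule: rev_cases) auto
  then have "length us = n - 1" using assms by auto
  then show ?thesis using F_padded_product[of us a] by (simp add: xs)
qed

lemma F_eq_nary_product: "F \<in> nary n \<Longrightarrow> F = nary_product n (binary_op n e F) e"
  unfolding nary_def nary_product_def
  by (rule extensionalityI[where A = "{xs. length xs = n}"]) (auto simp: PiE_def F_eq_product)

end

section \<open>Monotonicity and idempotence of the binary operation\<close>

lemma neutral_monotone_imp_mono:
  fixes F :: "'a::linorder list \<Rightarrow> 'a"
  assumes "monotone_fun n F" and neutral: "neutral_element n F e"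
    and "i < n" and "length as = n"
  shows "mono (\<lambda>x. F (as[i := x]))"
proof -
  \<comment> \<open>The direction does not depend on the fixed values, so a decreasing variable can
    be tested at the tuple of units.\<close>
  consider "mono (\<lambda>x. F (as[i := x]))" | "antimono (\<lambda>x. F ((replicate n e)[i := x]))"
    using assms unfolding monotone_fun_def monotone_in_variable_def by (metis length_replicate)
  then show ?thesis
  proof cases
    case 2
    have "(\<lambda>x. F ((replicate n e)[i := x])) = (\<lambda>x. x)"
      using neutral assms(3) by (auto simp: neutral_element_def)
    with 2 have "antimono (\<lambda>x::'a. x)" by simp
    then have "x = y" if "x \<le> y" for x y :: 'a
      using that by (auto simp: monotone_def)
    \<comment> \<open>Comparable elements coincide here, so every map is increasing.\<close>
    then show ?thesis by (metis monoI order_refl)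
  qed
qed

lemma monotone_band_binary_op:
  assumes n: "n \<ge> 2" and F: "F \<in> assoc_idem_mono_neutral n" and e: "neutral_element n F e"
  shows "monotone_band (binary_op n e F) e" and "F = nary_product n (binary_op n e F) e"
proof -
  interpret neutral_n_associative n F e
    using assms by unfold_locales (auto simp: assoc_idem_mono_neutral_def)
  show eq: "F = nary_product n (binary_op n e F) e"
    using F by (intro F_eq_nary_product) (simp add: assoc_idem_mono_neutral_def)
  have mono: "mono (\<lambda>x. F (as[i := x]))" if "i < n" "length as = n" for i as
    using F e that by (intro neutral_monotone_imp_mono) (auto simp: assoc_idem_mono_neutral_def)
  have left: "a \<bullet> c \<le> b \<bullet> c" if "a \<le> b" for a b c
    using monoD[OF mono[of 0 "[a] @ replicate (n - 2) e @ [c]"] that] n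
    by (simp add: binary_op_def)
  have right: "c \<bullet> a \<le> c \<bullet> b" if "a \<le> b" for a b c
    using monoD[OF mono[of "Suc (n - 2)" "[c] @ replicate (n - 2) e @ [a]"] that] n
    by (simp add: binary_op_def list_update_append)
  obtain k where k: "n = Suc (Suc k)"
    using n by (metis Suc_le_D numeral_2_eq_2 Suc_le_mono)
  \<comment> \<open>Two factors are split off so that the remaining \<open>k = n - 2\<close> can be
    compared with \<open>e\<close>.\<close>
  have power: "a \<bullet> (a \<bullet> foldr (binary_op n e F) (replicate k a) e) = a" for a
    using F k F_eq_product[of "replicate n a"]
    by (simp add: assoc_idem_mono_neutral_def idempotent_def)
  show "monotone_band (binary_op n e F) e"
  proof
    show "a \<bullet> c \<le> b \<bullet> d" if "a \<le> b" "c \<le> d" for a b c d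
      using left[OF that(1)] right[OF that(2)] by (rule order_trans)
    show "a \<bullet> a = a" for a
    proof (cases "e \<le> a")
      case True
      \<comment> \<open>Powers of \<open>a\<close> stay above \<open>e\<close>, so replacing the
        last \<open>k\<close> factors by \<open>e\<close> bounds the square of \<open>a\<close> by
        \<open>a\<close>.\<close>
      have "e \<le> foldr (binary_op n e F) (replicate j a) e" for j
      proof (induction j)
        case (Suc j)
        then show ?case using right[OF Suc, of a] True by simp
      qed simp
      then have "a \<bullet> (a \<bullet> e) \<le> a"
        using right power by metis
      then show ?thesis using right[OF True, of a] by simp
    next
      case False
      then have ae: "a \<le> e" by simp
      have "foldr (binary_op n e F) (replicate j a) e \<le> e" for j
      proof (induction j)
        case (Suc j)
        then show ?case using right[OF Suc, of a] ae by simp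
      qed simp
      then have "a \<le> a \<bullet> (a \<bullet> e)"
        using right power by metis
      then show ?thesis using right[OF ae, of a] by simp
    qed
  qed
qed

section \<open>Uniqueness of the neutral element and the bijection\<close>

lemma neutral_element_unique:
  assumes "n \<ge> 2" and "F \<in> assoc_idem_mono_neutral n"
    and "neutral_element n F e" and "neutral_element n F e'"
  shows "e' = e"
proof -
  interpret monotone_band "binary_op n e F" e
    using assms(1-3) by (rule monotone_band_binary_op(1))
  have "neutral_element n (nary_product n (binary_op n e F) e) e'"
    using assms(4) by (simp flip: monotone_band_binary_op(2)[OF assms(1-3)])
  with assms(1) show ?thesis by (rule nary_product_neutral_unique)
qed

lemma (in monoid) binary_part_eq_nary_product:
  assumes "binary_op n z F = f"
  shows "binary_part n z F = nary_product 2 f z"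
  unfolding binary_part_def nary_product_def
proof (rule restrict_ext)
  fix xs :: "'a list"
  assume "xs \<in> {xs. length xs = 2}"
  then obtain a b where "xs = [a, b]"
    by (auto simp: length_Suc_conv numeral_2_eq_2)
  moreover have "F ([a] @ replicate (n - 2) z @ [b]) = f a b"
    using assms by (auto simp: binary_op_def)
  ultimately show "F ([xs ! 0] @ replicate (n - 2) z @ [xs ! 1]) = foldr f xs z"
    by simp
qed

lemma binary_map_eq_binary_part:
  assumes "n \<ge> 2" and "F \<in> assoc_idem_mono_neutral n" and "neutral_element n F e"
  shows "binary_map n F = binary_part n e F"
proof -
  have "(SOME e. neutral_element n F e) = e"
    using assms by (blast intro: neutral_element_unique)
  then show ?thesis by (simp add: binary_map_def)
qed

text \<open>The map thus sends the \<open>n\<close>-fold product of a band to its 2-fold product;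
  injectivity and surjectivity both rest on this.\<close>

lemma binary_map_eq_nary_product:
  assumes "n \<ge> 2" and "F \<in> assoc_idem_mono_neutral n" and "neutral_element n F e"
  shows "binary_map n F = nary_product 2 (binary_op n e F) e"
proof -
  interpret monotone_band "binary_op n e F" e
    using assms by (rule monotone_band_binary_op(1))
  show ?thesis
    using binary_map_eq_binary_part[OF assms] binary_part_eq_nary_product[OF refl]
    by (rule trans)
qed

text \<open>The first conjunct certifies that \<open>SOME\<close> in \<open>binary_map\<close> makes
  no real choice.\<close>

theorem theorem2p3:
  fixes n :: nat
  assumes "n \<ge> 2"
  shows "(\<forall>F \<in> assoc_idem_mono_neutral n. \<forall>e :: 'a :: linorder.
            neutral_element n F e \<longrightarrow> binary_map n F = binary_part n e F) \<and>
         bij_betw (binary_map n)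
           (assoc_idem_mono_neutral n :: ('a list \<Rightarrow> 'a) set)
           (assoc_idem_mono_neutral 2 :: ('a list \<Rightarrow> 'a) set)"
proof (intro conjI ballI allI impI)
  show "binary_map n F = binary_part n e F"
    if "F \<in> assoc_idem_mono_neutral n" "neutral_element n F e" for F and e :: 'a
    using assms that by (rule binary_map_eq_binary_part)
  show "bij_betw (binary_map n)
      (assoc_idem_mono_neutral n :: ('a list \<Rightarrow> 'a) set) (assoc_idem_mono_neutral 2)"
  proof (rule bij_betw_imageI)
    show "inj_on (binary_map n) (assoc_idem_mono_neutral n :: ('a list \<Rightarrow> 'a) set)"
    proof (rule inj_onI)
      fix F F' :: "'a list \<Rightarrow> 'a"
      assume F: "F \<in> assoc_idem_mono_neutral n" and F': "F' \<in> assoc_idem_mono_neutral n"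
        and eq: "binary_map n F = binary_map n F'"
      obtain e e' where e: "neutral_element n F e" and e': "neutral_element n F' e'"
        using F F' by (auto simp: assoc_idem_mono_neutral_def)
      interpret A: monotone_band "binary_op n e F" e
        using assms F e by (rule monotone_band_binary_op(1))
      interpret B: monotone_band "binary_op n e' F'" e'
        using assms F' e' by (rule monotone_band_binary_op(1))
      \<comment> \<open>One function is the 2-fold product of two bands: uniqueness identifies their
        units, and evaluation then identifies their operations.\<close>
      have G: "nary_product 2 (binary_op n e F) e = nary_product 2 (binary_op n e' F') e'"
        using eq by (simp add: binary_map_eq_nary_product[OF assms F e]
            binary_map_eq_nary_product[OF assms F' e'])
      then have "e' = e"
        using A.nary_product_neutral_unique[of 2 e'] B.nary_product_neutral[of 2] by simp
      moreover from this have "binary_op n e F = binary_op n e' F'"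
        using A.binary_op_nary_product[of 2] B.binary_op_nary_product[of 2] G by simp
      ultimately have "nary_product n (binary_op n e F) e = nary_product n (binary_op n e' F') e'"
        by simp
      then show "F = F'"
        by (simp flip: monotone_band_binary_op(2)[OF assms F e]
            monotone_band_binary_op(2)[OF assms F' e'])
    qed
    show "binary_map n ` assoc_idem_mono_neutral n
        = (assoc_idem_mono_neutral 2 :: ('a list \<Rightarrow> 'a) set)"
    proof (intro equalityI image_subsetI subsetI)
      fix F :: "'a list \<Rightarrow> 'a"
      assume F: "F \<in> assoc_idem_mono_neutral n"
      then obtain e where e: "neutral_element n F e"
        by (auto simp: assoc_idem_mono_neutral_def)
      interpret monotone_band "binary_op n e F" e
        using assms F e by (rule monotone_band_binary_op(1))
      show "binary_map n F \<in> assoc_idem_mono_neutral 2"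
        using binary_map_eq_nary_product[OF assms F e] nary_product_mem[of 2] by simp
    next
      fix G :: "'a list \<Rightarrow> 'a"
      assume G: "G \<in> assoc_idem_mono_neutral 2"
      then obtain e where e: "neutral_element 2 G e"
        by (auto simp: assoc_idem_mono_neutral_def)
      interpret monotone_band "binary_op 2 e G" e
        using order_refl G e by (rule monotone_band_binary_op(1))
      \<comment> \<open>\<open>G\<close> is the 2-fold product of its own band; the
        \<open>n\<close>-fold product of that band is the preimage.\<close>
      let ?F = "nary_product n (binary_op 2 e G) e"
      have F: "?F \<in> assoc_idem_mono_neutral n"
        using assms by (intro nary_product_mem) simp
      have "binary_map n ?F = nary_product 2 (binary_op 2 e G) e"
        using binary_map_eq_nary_product[OF assms F nary_product_neutral]
          binary_op_nary_product[OF assms] by simp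
      also have "\<dots> = G"
        by (rule monotone_band_binary_op(2)[OF order_refl G e, symmetric])
      finally show "G \<in> binary_map n ` assoc_idem_mono_neutral n"
        using F by (intro image_eqI[where x = ?F]) simp_all
    qed
  qed
qed

end
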